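(* Assume that $\Omega_0=\{x\in C: f(x)\le f(x_0)\}$ is bounded and that $\theta_k\le\bar\theta<1$ for all $k\ge0$. Then the G-LMM-IP is well defined (i.e., at every iteration the backtracking loop in Step 4 ends after a finite number of backtrackings), and any accumulation point of the sequence $\{x_k\}$ it generates is a stationary point of $\min_{x\in C} f(x)$.
   Context: Setting: $C\subset\mathbb{R}^n$ is a nonempty closed convex set contained in an open set $\Omega\subset\mathbb{R}^n$, $F:\Omega\to\mathbb{R}^m$ is continuously differentiable with Jacobian $F'(x)$, and the set $C^*=\{x\in C:F(x)=0\}$ is assumed nonempty. $\|\cdot\|$ is the Euclidean norm. Put $f(x):=\frac12\|F(x)\|^2$. A point $x\in C$ is a stationary point of $\min_{x\in C}f(x)$ if $\langle\nabla f(x),z-x\rangle\ge0$ for all $z\in C$. Inexact projection: for $x\in\mathbb{R}^n$, $\varepsilon\ge0$, an $\varepsilon$-projection of $x$ onto $C$, denoted $P_C(x,\varepsilon)$, is any point $p\in C$ with $\langle x-p,y-p\rangle\le\varepsilon$ for all $y\in C$. Method G-LMM-IP. Step 0. Let $x_0\in C$, an integer $M\ge0$, $\eta_1>0$, $\eta_3>\eta_2>0$, $\gamma,\beta\in(0,1)$ and $\{\theta_j\}\subset[0,\infty)$ be given. Set $k=0$, $m_0=0$. Step 1. If $F(x_k)=0$, stop; otherwise set $\mu_k:=\|F(x_k)\|^2$ and compute $d_k^U\in\mathbb{R}^n$ with $(F'(x_k)^TF'(x_k)+\mu_kI)d_k^U=-F'(x_k)^TF(x_k)$. Step 2. Set $\varepsilon_k:=\theta_k^2\|d_k^U\|^2$,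 compute an $\varepsilon_k$-projection $P_C(x_k+d_k^U,\varepsilon_k)$, and set $\bar d_k:=P_C(x_k+d_k^U,\varepsilon_k)-x_k$. If $|\langle\nabla f(x_k),\bar d_k\rangle|>\eta_1\|\bar d_k\|^2$ and $\eta_2\|\nabla f(x_k)\|\le\|\bar d_k\|\le\eta_3\|\nabla f(x_k)\|$, set $d_k=-\operatorname{sgn}(\langle\nabla f(x_k),\bar d_k\rangle)\,\bar d_k$ and go to Step 4. Step 3. Compute $y_k\in C$ such that $\langle x_k-\nabla f(x_k)-y_k,x-y_k\rangle\le\theta_k^2\|y_k-x_k\|^2$ for all $x\in C$, and set $d_k=y_k-x_k$. Step 4. Set $\alpha=1$. While $f(x_k+\alpha d_k)>\max_{0\le j\le m_k}\{f(x_{k-j})\}+\gamma\alpha\langle\nabla f(x_k),d_k\rangle$, replace $\alpha$ by $\beta\alpha$. Step 5. Set $\alpha_k=\alpha$, $x_{k+1}=x_k+\alpha_kd_k$, replace $k$ by $k+1$, choose an integer $m_k$ with $0\le m_k\le\min\{m_{k-1}+1,M\}$, and go to Step 1.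
   Formalization: Added assumption: whenever Step 2 is accepted with positive inner product of the gradient and the projected direction (so the direction is reversed), the next iterate lies in C; without it iterates can leave C and the backtracking loop in Step 4 may never end. *)

theory Defs
  imports "HOL-Analysis.Analysis"
begin

definition gradient :: "('a::real_inner \<Rightarrow> real) \<Rightarrow> 'a \<Rightarrow> 'a" where
  "gradient f x = (THE D. GDERIV f x :> D)"

definition stationary_point :: "('a::real_inner) set \<Rightarrow> ('a \<Rightarrow> real) \<Rightarrow> 'a \<Rightarrow> bool" where
  "stationary_point C f x \<longleftrightarrow> x \<in> C \<and> (\<forall>z\<in>C. inner (gradient f x) (z - x) \<ge> 0)"

definition merit :: "('a \<Rightarrow> 'b::real_normed_vector) \<Rightarrow> 'a \<Rightarrow> real" where
  "merit F x = 1/2 * (norm (F x))\<^sup>2"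

text \<open>Inexact projections are not unique, so \<open>P\<^sub>C(u,\<epsilon>)\<close> is a relation between \<open>u\<close> and \<open>p\<close>.\<close>

definition eps_projection :: "('a::real_inner) set \<Rightarrow> 'a \<Rightarrow> real \<Rightarrow> 'a \<Rightarrow> bool" where
  "eps_projection C u \<epsilon> p \<longleftrightarrow> p \<in> C \<and> (\<forall>y\<in>C. inner (u - p) (y - p) \<le> \<epsilon>)"

definition lm_direction :: "(real^'n \<Rightarrow> real^'m) \<Rightarrow> real^'n \<Rightarrow> real^'n \<Rightarrow> bool" where
  "lm_direction F x dU \<longleftrightarrow>
     (let J = jacobian F (at x); \<mu> = (norm (F x))\<^sup>2
      in (transpose J ** J + \<mu> *\<^sub>R mat 1) *v dU = - (transpose J *v F x))"

definition projected_direction_ok :: "real \<Rightarrow> real \<Rightarrow> real \<Rightarrow> 'a::real_inner \<Rightarrow> 'a \<Rightarrow> bool" where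
  "projected_direction_ok \<eta>1 \<eta>2 \<eta>3 g dbar \<longleftrightarrow>
     \<bar>inner g dbar\<bar> > \<eta>1 * (norm dbar)\<^sup>2 \<and>
     \<eta>2 * norm g \<le> norm dbar \<and> norm dbar \<le> \<eta>3 * norm g"

text \<open>
  Steps 1--3 of the method at a point \<open>x\<close> where it does not stop: \<open>p\<close> is the inexact
  projection of Step 2 and \<open>d\<close> the resulting search direction.
\<close>

definition search_direction ::
  "(real^'n) set \<Rightarrow> (real^'n \<Rightarrow> real^'m) \<Rightarrow> real \<Rightarrow> real \<Rightarrow> real \<Rightarrow> real \<Rightarrow>
   real^'n \<Rightarrow> real^'n \<Rightarrow> real^'n \<Rightarrow> bool" where
  "search_direction C F \<eta>1 \<eta>2 \<eta>3 \<theta> x p d \<longleftrightarrow>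
     F x \<noteq> 0 \<and>
     (\<exists>dU. lm_direction F x dU \<and> eps_projection C (x + dU) (\<theta>\<^sup>2 * (norm dU)\<^sup>2) p) \<and>
     (let g = gradient (merit F) x; dbar = p - x in
      if projected_direction_ok \<eta>1 \<eta>2 \<eta>3 g dbar
      then d = - sgn (inner g dbar) *\<^sub>R dbar
      else (\<exists>y\<in>C. (\<forall>z\<in>C. inner (x - g - y) (z - y) \<le> \<theta>\<^sup>2 * (norm (y - x))\<^sup>2) \<and> d = y - x))"

text \<open>Exit condition of the loop in Step 4. Since \<open>m k \<le> k\<close>, the subtraction \<open>k - j\<close> is exact.\<close>

definition sufficient_decrease ::
  "('a::real_inner \<Rightarrow> real) \<Rightarrow> real \<Rightarrow> (nat \<Rightarrow> 'a) \<Rightarrow> (nat \<Rightarrow> nat) \<Rightarrow> nat \<Rightarrow> 'a \<Rightarrow> real \<Rightarrow> bool" where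
  "sufficient_decrease f \<gamma> x m k d a \<longleftrightarrow>
     f (x k + a *\<^sub>R d) \<le> (MAX j\<in>{..m k}. f (x (k - j))) + \<gamma> * a * inner (gradient f (x k)) d"

text \<open>\<open>a\<close> is the value with which the loop
  ``set \<open>a = 1\<close>; while not \<open>P a\<close>, replace \<open>a\<close> by \<open>\<beta> a\<close>'' exits.\<close>

definition backtracking_result :: "real \<Rightarrow> (real \<Rightarrow> bool) \<Rightarrow> real \<Rightarrow> bool" where
  "backtracking_result \<beta> P a \<longleftrightarrow> (\<exists>i. a = \<beta> ^ i \<and> P (\<beta> ^ i) \<and> (\<forall>j<i. \<not> P (\<beta> ^ j)))"

text \<open>Iteration \<open>k\<close> is carried out completely, producing \<open>x (Suc k)\<close> and \<open>m (Suc k)\<close>.\<close>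

definition glmm_iteration ::
  "(real^'n) set \<Rightarrow> (real^'n \<Rightarrow> real^'m) \<Rightarrow> nat \<Rightarrow> real \<Rightarrow> real \<Rightarrow> real \<Rightarrow> real \<Rightarrow> real \<Rightarrow> (nat \<Rightarrow> real) \<Rightarrow>
   (nat \<Rightarrow> real^'n) \<Rightarrow> (nat \<Rightarrow> real^'n) \<Rightarrow> (nat \<Rightarrow> real^'n) \<Rightarrow> (nat \<Rightarrow> real) \<Rightarrow> (nat \<Rightarrow> nat) \<Rightarrow>
   nat \<Rightarrow> bool" where
  "glmm_iteration C F M \<eta>1 \<eta>2 \<eta>3 \<gamma> \<beta> \<theta> x p d \<alpha> m k \<longleftrightarrow>
     search_direction C F \<eta>1 \<eta>2 \<eta>3 (\<theta> k) (x k) (p k) (d k) \<and>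
     backtracking_result \<beta> (sufficient_decrease (merit F) \<gamma> x m k (d k)) (\<alpha> k) \<and>
     x (Suc k) = x k + \<alpha> k *\<^sub>R d k \<and>
     m (Suc k) \<le> min (m k + 1) M"

text \<open>
  When Step 2 is accepted and the projected direction is an ascent direction, the method uses
  the reversed direction \<open>x k - p k\<close>, along which convexity of \<open>C\<close> does not keep the next
  iterate in \<open>C\<close>.  In all other cases the next iterate is in \<open>C\<close> automatically.
\<close>

definition reversal_feasible ::
  "(real^'n) set \<Rightarrow> (real^'n \<Rightarrow> real^'m) \<Rightarrow> real \<Rightarrow> real \<Rightarrow> real \<Rightarrow>
   (nat \<Rightarrow> real^'n) \<Rightarrow> (nat \<Rightarrow> real^'n) \<Rightarrow> nat \<Rightarrow> bool" where
  "reversal_feasible C F \<eta>1 \<eta>2 \<eta>3 x p k \<longleftrightarrow>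
     (let g = gradient (merit F) (x k); dbar = p k - x k in
      projected_direction_ok \<eta>1 \<eta>2 \<eta>3 g dbar \<and> inner g dbar > 0 \<longrightarrow> x (Suc k) \<in> C)"

end

theory Submission
  imports Defs
begin

text \<open>
  Write \<open>f\<close> for the merit function and \<open>g\<close> for its gradient.  Whichever step supplies the search
  direction \<open>d\<close> at a feasible point \<open>x\<close>, two facts hold and carry the whole proof:
  \<^item> \<open>\<langle>g x, d\<rangle> \<le> - c \<parallel>d\<parallel>\<^sup>2\<close> with a constant \<open>c > 0\<close>, common to all iterations
    because \<open>\<theta> k \<le> \<theta>bar < 1\<close> (lemma \<open>search_direction_descent\<close>);
  \<^item> \<open>- \<langle>g x, z - x\<rangle>\<close> is at most \<open>\<parallel>d\<parallel>\<close> times a quantity that stays bounded, for each \<open>z\<close> in \<open>C\<close>, so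
    that a small direction means an almost stationary point
    (lemma \<open>search_direction_bounds_stationarity\<close>).

  By the first fact a nonzero direction is a descent direction, hence some step \<open>\<beta> ^ i\<close> satisfies
  even the monotone Armijo condition, and the backtracking loop ends; for \<open>d = 0\<close> the full step is
  accepted.

  For the convergence claim, put \<open>\<delta> k = - \<gamma> \<alpha> k \<langle>g (x k), d k\<rangle>\<close>, the decrease guaranteed below the
  reference value \<open>max f (x (k - j))\<close>.  Since \<open>\<alpha> k \<le> 1\<close>, the first fact bounds
  \<open>\<parallel>x (Suc k) - x k\<parallel>\<^sup>2\<close> by a multiple of \<open>\<delta> k\<close>.  The iterates stay in the initial level set, which is
  compact, so \<open>f\<close> is uniformly continuous there and a small \<open>\<delta> k\<close> forces a small change of \<open>f\<close>.
  This is what the argument of Grippo, Lampariello and Lucidi for nonmonotone line searches needs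
  to give \<open>\<delta> k \<longlonglongrightarrow> 0\<close> along the entire sequence (lemma \<open>nonmonotone_decrease_tendsto_0\<close>).

  Along a subsequence of iterates that converges to \<open>xbar\<close>, pass to limits \<open>v\<close> of the directions and
  \<open>a\<close> of the step lengths.  If \<open>a > 0\<close>, then \<open>\<delta> k \<longlonglongrightarrow> 0\<close> gives \<open>\<langle>g xbar, v\<rangle> = 0\<close>.  If \<open>a = 0\<close>, the step
  \<open>\<alpha> k / \<beta>\<close> was rejected from some index on, and the mean value theorem turns the rejections into
  \<open>\<langle>g xbar, v\<rangle> \<ge> \<gamma> \<langle>g xbar, v\<rangle>\<close>.  In both cases \<open>\<langle>g xbar, v\<rangle> \<ge> 0\<close>, while the first fact gives
  \<open>\<langle>g xbar, v\<rangle> \<le> - c \<parallel>v\<parallel>\<^sup>2\<close>; so \<open>v = 0\<close> (lemma \<open>line_search_directions_vanish\<close>).  The second fact then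
  passes to the limit and says that \<open>xbar\<close> is stationary.
\<close>

section \<open>Nonmonotone decrease of real sequences\<close>

lemma window_max_ge:
  fixes \<phi> :: "nat \<Rightarrow> real"
  assumes "j \<le> m k"
  shows "\<phi> (k - j) \<le> (MAX j\<in>{..m k}. \<phi> (k - j))"
  using assms by (intro Max_ge) auto

text \<open>
  The window grows by at most one index per step, so each value it contains at \<open>Suc k\<close> is either
  the new one, below the old maximum, or was already in the window at \<open>k\<close>.
\<close>

lemma window_max_antimono:
  fixes \<phi> \<delta> :: "nat \<Rightarrow> real"
  assumes "\<phi> (Suc k) \<le> (MAX j\<in>{..m k}. \<phi> (k - j)) - \<delta> k"
    and "\<delta> k \<ge> 0" and "m (Suc k) \<le> Suc (m k)"
  shows "(MAX j\<in>{..m (Suc k)}. \<phi> (Suc k - j)) \<le> (MAX j\<in>{..m k}. \<phi> (k - j))"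
proof -
  have "\<phi> (Suc k - j) \<le> (MAX j\<in>{..m k}. \<phi> (k - j))" if "j \<le> m (Suc k)" for j
  proof (cases j)
    case 0
    then show ?thesis using assms by simp
  next
    case (Suc i)
    then have "i \<le> m k" using that assms(3) by simp
    then show ?thesis using window_max_ge[of i m k \<phi>] Suc by simp
  qed
  then show ?thesis by (subst Max_le_iff) auto
qed

lemma window_le_initial:
  fixes \<phi> \<delta> :: "nat \<Rightarrow> real"
  assumes "m 0 = 0"
    and "\<And>k. k < K \<Longrightarrow> m (Suc k) \<le> Suc (m k)"
    and "\<And>k. k < K \<Longrightarrow> \<phi> (Suc k) \<le> (MAX j\<in>{..m k}. \<phi> (k - j)) - \<delta> k"
    and "\<And>k. k < K \<Longrightarrow> \<delta> k \<ge> 0"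
  shows "(MAX j\<in>{..m K}. \<phi> (K - j)) \<le> \<phi> 0"
  using assms(2-4)
proof (induction K)
  case 0
  then show ?case using assms(1) by simp
next
  case (Suc K)
  have "(MAX j\<in>{..m (Suc K)}. \<phi> (Suc K - j)) \<le> (MAX j\<in>{..m K}. \<phi> (K - j))"
    by (rule window_max_antimono[where \<delta> = \<delta>]) (use Suc.prems in auto)
  also have "\<dots> \<le> \<phi> 0" by (rule Suc.IH) (use Suc.prems in auto)
  finally show ?case .
qed

text \<open>
  The window maxima \<open>V k\<close> decrease to a limit \<open>L\<close>, and \<open>V k\<close> is attained at an index \<open>l k\<close> at distance
  at most \<open>M\<close> from \<open>k\<close>.  Values of \<open>\<phi>\<close> before \<open>l k\<close> are controlled by walking backwards: if
  \<open>\<phi> (l k - j)\<close> tends to \<open>L\<close>, then the decrease into that index is squeezed between \<open>0\<close> and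
  \<open>V - \<phi>\<close>, so it tends to \<open>0\<close>, and the last hypothesis makes the value one index earlier tend to \<open>L\<close>
  too.  With \<open>j \<le> M\<close> the indices \<open>l k - j\<close> cover all natural numbers, so \<open>\<phi>\<close> itself
  converges to \<open>L\<close>, and \<open>\<delta> k \<le> V k - \<phi> (Suc k)\<close> vanishes.
\<close>

lemma nonmonotone_decrease_tendsto_0:
  fixes \<phi> \<delta> :: "nat \<Rightarrow> real"
  assumes m0: "m 0 = 0" and m_Suc: "\<And>k. m (Suc k) \<le> min (m k + 1) M"
    and dec: "\<And>k. \<phi> (Suc k) \<le> (MAX j\<in>{..m k}. \<phi> (k - j)) - \<delta> k"
    and \<delta>_nonneg: "\<And>k. \<delta> k \<ge> 0"
    and below: "\<And>k. b \<le> \<phi> k"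
    and small: "\<And>\<epsilon>. \<epsilon> > 0 \<Longrightarrow> \<exists>\<eta>>0. \<forall>k. \<delta> k < \<eta> \<longrightarrow> \<bar>\<phi> (Suc k) - \<phi> k\<bar> < \<epsilon>"
  shows "\<delta> \<longlonglongrightarrow> 0"
proof -
  define V where "V k = (MAX j\<in>{..m k}. \<phi> (k - j))" for k
  have m_le: "m k \<le> k" "m k \<le> M" for k
  proof -
    show "m k \<le> k"
    proof (induction k)
      case (Suc k)
      then show ?case using m_Suc[of k] by simp
    qed (simp add: m0)
    show "m k \<le> M" using m0 m_Suc by (cases k) auto
  qed
  have "V (Suc k) \<le> V k" for k
    unfolding V_def using m_Suc[of k] dec[of k] \<delta>_nonneg[of k]
    by (intro window_max_antimono[where \<delta> = \<delta>]) auto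
  then have "decseq V" by (rule decseq_SucI)
  have \<phi>_le_V: "\<phi> k \<le> V k" for k
    unfolding V_def using window_max_ge[of 0 m k \<phi>] by simp
  obtain L where V_lim: "V \<longlonglongrightarrow> L"
    using decseq_convergent[OF \<open>decseq V\<close>, of b] below \<phi>_le_V by (metis order_trans)
  have "\<exists>j\<le>m k. \<phi> (k - j) = V k" for k
  proof -
    have "V k \<in> (\<lambda>j. \<phi> (k - j)) ` {..m k}" unfolding V_def by (rule Max_in) auto
    then show ?thesis by force
  qed
  then obtain off where off: "\<And>k. off k \<le> m k" "\<And>k. \<phi> (k - off k) = V k"
    by metis
  define l where "l k = k - off k" for k
  have l_bounds: "k - M \<le> l k" "l k \<le> k" for k
    unfolding l_def using off(1)[of k] m_le(2)[of k] by auto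
  have l_top: "filterlim (\<lambda>k. l k - j) at_top sequentially" for j
  proof -
    have "filterlim (\<lambda>k::nat. k - (M + j)) at_top sequentially"
      by (rule filterlim_minus_const_nat_at_top)
    then show ?thesis
      by (rule filterlim_at_top_mono) (simp only: diff_diff_left[symmetric], intro always_eventually allI diff_le_mono l_bounds)
  qed
  have shifted: "(\<lambda>k. \<phi> (l k - j)) \<longlonglongrightarrow> L" for j
  proof (induction j)
    case 0
    then show ?case using V_lim off(2) by (simp add: l_def)
  next
    case (Suc j)
    define i where "i k = l k - Suc j" for k
    have i_top: "filterlim i at_top sequentially" unfolding i_def by (rule l_top)
    \<comment> \<open>Truncated subtraction makes this false for those \<open>k\<close> with \<open>l k \<le> j\<close>, which are finitely many.\<close>
    have Suc_i: "\<forall>\<^sub>F k in sequentially. Suc (i k) = l k - j"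
      using l_top[of j] unfolding filterlim_at_top
      by (rule allE[where x = 1]) (auto simp: i_def elim!: eventually_mono)
    have \<phi>_Suc: "(\<lambda>k. \<phi> (Suc (i k))) \<longlonglongrightarrow> L"
      by (rule Lim_transform_eventually[OF Suc.IH])
        (use Suc_i in \<open>auto elim!: eventually_mono\<close>)
    have "(\<lambda>k. V (i k)) \<longlonglongrightarrow> L" by (rule filterlim_compose[OF V_lim i_top])
    from tendsto_diff[OF this \<phi>_Suc]
    have gap: "(\<lambda>k. V (i k) - \<phi> (Suc (i k))) \<longlonglongrightarrow> 0" by simp
    have \<delta>_lim: "(\<lambda>k. \<delta> (i k)) \<longlonglongrightarrow> 0"
    proof (rule tendsto_sandwich[OF _ _ tendsto_const gap])
      show "\<forall>\<^sub>F k in sequentially. 0 \<le> \<delta> (i k)" using \<delta>_nonneg by simp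
      show "\<forall>\<^sub>F k in sequentially. \<delta> (i k) \<le> V (i k) - \<phi> (Suc (i k))"
        using dec unfolding V_def[symmetric] by (simp add: le_diff_eq add.commute)
    qed
    have "(\<lambda>k. \<phi> (Suc (i k)) - \<phi> (i k)) \<longlonglongrightarrow> 0"
    proof (rule tendstoI)
      fix \<epsilon> :: real assume "\<epsilon> > 0"
      then obtain \<eta> where "\<eta> > 0" and \<eta>: "\<And>k. \<delta> k < \<eta> \<Longrightarrow> \<bar>\<phi> (Suc k) - \<phi> k\<bar> < \<epsilon>"
        using small by blast
      show "\<forall>\<^sub>F k in sequentially. dist (\<phi> (Suc (i k)) - \<phi> (i k)) 0 < \<epsilon>"
        using order_tendstoD(2)[OF \<delta>_lim \<open>\<eta> > 0\<close>]
        by eventually_elim (simp add: \<eta>)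
    qed
    from tendsto_diff[OF \<phi>_Suc this] show ?case by (simp add: i_def)
  qed
  have \<phi>_lim: "\<phi> \<longlonglongrightarrow> L"
  proof -
    \<comment> \<open>Which \<open>j\<close> satisfies \<open>n = l (n + M) - j\<close> depends on \<open>n\<close>; the sum over all candidates
      avoids choosing.  The shift \<open>M\<close> ensures \<open>n \<le> l (n + M)\<close>.\<close>
    have "(\<lambda>n. \<Sum>j\<le>M. \<bar>\<phi> (l (n + M) - j) - L\<bar>) \<longlonglongrightarrow> (\<Sum>j\<le>M. 0)"
    proof (intro tendsto_sum)
      fix j
      have "(\<lambda>k. \<bar>\<phi> (l k - j) - L\<bar>) \<longlonglongrightarrow> 0"
        using tendsto_rabs[OF LIM_zero[OF shifted[of j]]] by simp
      from LIMSEQ_ignore_initial_segment[OF this, of "M"]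
      show "(\<lambda>n. \<bar>\<phi> (l (n + M) - j) - L\<bar>) \<longlonglongrightarrow> 0" by (simp add: add.assoc)
    qed
    then have bound_lim: "(\<lambda>n. \<Sum>j\<le>M. \<bar>\<phi> (l (n + M) - j) - L\<bar>) \<longlonglongrightarrow> 0"
      by simp
    have "\<bar>\<phi> n - L\<bar> \<le> (\<Sum>j\<le>M. \<bar>\<phi> (l (n + M) - j) - L\<bar>)" for n
    proof -
      define j where "j = l (n + M) - n"
      have "n = l (n + M) - j" "j \<le> M"
        unfolding j_def using l_bounds[of "n + M"] by auto
      then have "\<bar>\<phi> n - L\<bar> = \<bar>\<phi> (l (n + M) - j) - L\<bar>" by metis
      also have "\<dots> \<le> (\<Sum>j\<le>M. \<bar>\<phi> (l (n + M) - j) - L\<bar>)"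
        using \<open>j \<le> M\<close> by (intro member_le_sum) auto
      finally show ?thesis .
    qed
    then have "(\<lambda>n. \<phi> n - L) \<longlonglongrightarrow> 0"
      by (intro Lim_null_comparison[OF _ bound_lim]) simp
    then show ?thesis by (rule LIM_zero_cancel)
  qed
  have gap: "(\<lambda>k. V k - \<phi> (Suc k)) \<longlonglongrightarrow> 0"
    using tendsto_diff[OF V_lim LIMSEQ_Suc[OF \<phi>_lim]] by simp
  show ?thesis
    by (rule tendsto_sandwich[OF _ _ tendsto_const gap])
      (use \<delta>_nonneg dec in \<open>auto simp: V_def[symmetric] le_diff_eq add.commute\<close>)
qed

section \<open>The gradient of the merit function\<close>

lemma gradient_eq:
  assumes "GDERIV f x :> D"
  shows "gradient f x = D"
  unfolding gradient_def
proof (rule the_equality)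
  show "GDERIV f x :> D" by (rule assms)
  fix E assume "GDERIV f x :> E"
  then have "(\<lambda>h. inner h E) = (\<lambda>h. inner h D)"
    using assms unfolding gderiv_def by (rule has_derivative_unique)
  then show "E = D" by (metis inner_commute vector_eq_rdot)
qed

lemma GDERIV_merit:
  fixes F :: "real^'n \<Rightarrow> real^'m"
  assumes "F differentiable (at x)"
  shows "GDERIV (merit F) x :> F x v* jacobian F (at x)"
proof -
  have F': "(F has_derivative (\<lambda>h. jacobian F (at x) *v h)) (at x)"
    using assms jacobian_works by blast
  have "((\<lambda>z. 1/2 * inner (F z) (F z)) has_derivative
      (\<lambda>h. inner h (F x v* jacobian F (at x)))) (at x)"
    by (rule derivative_eq_intros F' refl)+
      (auto simp: inner_commute[of _ "_ v* _"] dot_lmul_matrix inner_commute[of "_ *v _"])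
  then show ?thesis
    unfolding gderiv_def merit_def by (simp add: power2_norm_eq_inner)
qed

lemma continuous_on_vector_matrix_mult:
  fixes v :: "'a::topological_space \<Rightarrow> real^'m" and A :: "'a \<Rightarrow> real^'n^'m"
  assumes "continuous_on S v" and "continuous_on S A"
  shows "continuous_on S (\<lambda>z. v z v* A z)"
  unfolding vector_matrix_mult_def
  by (intro continuous_intros continuous_on_component assms)

section \<open>Armijo line searches\<close>

lemma GDERIV_along_line:
  assumes "GDERIV f (x + t *\<^sub>R d) :> D"
  shows "((\<lambda>t. f (x + t *\<^sub>R d)) has_real_derivative inner D d) (at t)"
proof -
  have "((\<lambda>t. x + t *\<^sub>R d) has_derivative (\<lambda>h. h *\<^sub>R d)) (at t)"
    by (rule derivative_eq_intros refl)+ simp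
  from has_derivative_compose[OF this assms[unfolded gderiv_def]]
  show ?thesis
    unfolding has_field_derivative_def
    by (simp add: mult.commute inner_commute mult_commute_abs)
qed

text \<open>
  The difference quotients along \<open>d\<close> tend to the slope \<open>\<langle>g, d\<rangle>\<close>, which is negative and hence smaller
  than \<open>\<gamma> \<langle>g, d\<rangle>\<close>.
\<close>

lemma armijo_backtracking_terminates:
  assumes "GDERIV f x :> g" and "inner g d < 0"
    and "\<gamma> < 1" and "0 < \<beta>" "\<beta> < 1"
  shows "\<exists>i. f (x + \<beta> ^ i *\<^sub>R d) \<le> f x + \<gamma> * \<beta> ^ i * inner g d"
proof -
  have "((\<lambda>t. f (x + t *\<^sub>R d)) has_real_derivative inner g d) (at 0)"
    using assms(1) by (intro GDERIV_along_line) simp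
  then have quot: "((\<lambda>t. (f (x + t *\<^sub>R d) - f x) / t) \<longlongrightarrow> inner g d) (at 0)"
    unfolding DERIV_def by simp
  have "filterlim (\<lambda>i. \<beta> ^ i) (at 0) sequentially"
    unfolding filterlim_at using assms by (auto intro!: LIMSEQ_power_zero)
  note lim = filterlim_compose[OF quot this]
  have "inner g d < \<gamma> * inner g d" using assms(2,3) by simp
  from order_tendstoD(2)[OF lim this]
  obtain i where "(f (x + \<beta> ^ i *\<^sub>R d) - f x) / \<beta> ^ i < \<gamma> * inner g d"
    by (auto simp: eventually_sequentially)
  then have "f (x + \<beta> ^ i *\<^sub>R d) \<le> f x + \<gamma> * \<beta> ^ i * inner g d"
    using assms(4) by (simp add: divide_less_eq algebra_simps)
  then show ?thesis by blast
qed

lemma backtracking_result_bounds: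
  assumes "backtracking_result \<beta> P a" and "0 < \<beta>" "\<beta> < 1"
  shows "0 < a" "a \<le> 1"
  using assms by (auto simp: backtracking_result_def power_le_one)

lemma backtracking_result_previous_fails:
  assumes "backtracking_result \<beta> P a" and "0 < \<beta>"
  shows "a = 1 \<or> \<not> P (a / \<beta>)"
proof -
  obtain i where i: "a = \<beta> ^ i" "\<forall>j<i. \<not> P (\<beta> ^ j)"
    using assms(1) by (auto simp: backtracking_result_def)
  show ?thesis
  proof (cases i)
    case (Suc j)
    then have "a / \<beta> = \<beta> ^ j" using i assms(2) by simp
    then show ?thesis using i Suc by simp
  qed (use i in simp)
qed

text \<open>
  By the mean value theorem a rejected step \<open>T n\<close> contains a point of the segment where the slope
  along \<open>D n\<close> is at least \<open>\<gamma>\<close> times the slope at \<open>X n\<close>.  As \<open>T n\<close> vanishes, both points tend to \<open>x\<close>.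
  Since \<open>\<Omega>\<close> is open, the segments lie in a ball around \<open>x\<close> inside \<open>\<Omega>\<close> from some index on, even when
  the rejected trial points leave the feasible set.
\<close>

lemma rejected_steps_limit_slope:
  fixes f :: "'a::euclidean_space \<Rightarrow> real"
  assumes "open \<Omega>" and grad: "\<And>z. z \<in> \<Omega> \<Longrightarrow> GDERIV f z :> g z"
    and cont: "continuous_on \<Omega> g"
    and X: "X \<longlonglongrightarrow> x" "x \<in> \<Omega>" and D: "D \<longlonglongrightarrow> v"
    and T: "T \<longlonglongrightarrow> 0" "\<And>n. T n > 0"
    and rejected: "\<forall>\<^sub>F n in sequentially.
      f (X n + T n *\<^sub>R D n) \<ge> f (X n) + \<gamma> * T n * inner (g (X n)) (D n)"
  shows "inner (g x) v \<ge> \<gamma> * inner (g x) v"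
proof -
  obtain e where "e > 0" and e: "ball x e \<subseteq> \<Omega>"
    using \<open>open \<Omega>\<close> X(2) openE by blast
  have g_cont: "isCont g x"
    using cont \<open>open \<Omega>\<close> X(2) by (simp add: continuous_on_eq_continuous_at)
  have "(\<lambda>n. X n + T n *\<^sub>R D n) \<longlonglongrightarrow> x + 0 *\<^sub>R v"
    by (intro tendsto_intros X T D)
  then have Y: "(\<lambda>n. X n + T n *\<^sub>R D n) \<longlonglongrightarrow> x" by simp
  have X_near: "\<forall>\<^sub>F n in sequentially. X n \<in> ball x e"
    and Y_near: "\<forall>\<^sub>F n in sequentially. X n + T n *\<^sub>R D n \<in> ball x e"
    using X(1) Y \<open>e > 0\<close> by (auto intro!: topological_tendstoD simp del: mem_ball)
  have "\<forall>\<^sub>F n in sequentially. \<exists>t. 0 \<le> t \<and> t \<le> T n \<and>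
      \<gamma> * inner (g (X n)) (D n) \<le> inner (g (X n + t *\<^sub>R D n)) (D n)"
    using X_near Y_near rejected
  proof eventually_elim
    case (elim n)
    have in_\<Omega>: "X n + t *\<^sub>R D n \<in> \<Omega>" if "0 \<le> t" "t \<le> T n" for t
    proof -
      have "(1 - t / T n) *\<^sub>R X n + (t / T n) *\<^sub>R (X n + T n *\<^sub>R D n) \<in> ball x e"
        using elim(1,2) that T(2)[of n] by (intro convexD[OF convex_ball]) auto
      moreover have "(1 - t / T n) *\<^sub>R X n + (t / T n) *\<^sub>R (X n + T n *\<^sub>R D n) = X n + t *\<^sub>R D n"
        using T(2)[of n] by (simp add: algebra_simps)
      ultimately show ?thesis using e by auto
    qed
    have "\<exists>t\<in>{0..T n}. f (X n + T n *\<^sub>R D n) - f (X n + 0 *\<^sub>R D n)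
        = inner (g (X n + t *\<^sub>R D n)) (D n) * (T n - 0)"
    proof (rule mvt_very_simple)
      show "((\<lambda>t. f (X n + t *\<^sub>R D n)) has_derivative
          (*) (inner (g (X n + t *\<^sub>R D n)) (D n))) (at t within {0..T n})"
        if "0 \<le> t" "t \<le> T n" for t
        using GDERIV_along_line[OF grad[OF in_\<Omega>[OF that]]]
        unfolding has_field_derivative_def by (rule has_derivative_at_withinI)
    qed (use T(2)[of n] in simp)
    then obtain t where t: "0 \<le> t" "t \<le> T n"
      "f (X n + T n *\<^sub>R D n) - f (X n) = inner (g (X n + t *\<^sub>R D n)) (D n) * T n"
      by auto
    then have "(\<gamma> * inner (g (X n)) (D n)) * T n \<le> inner (g (X n + t *\<^sub>R D n)) (D n) * T n"
      using elim(3) by (simp add: algebra_simps)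
    then show ?case using t T(2)[of n] by (auto dest: mult_right_le_imp_le)
  qed
  then obtain t where t: "\<forall>\<^sub>F n in sequentially. 0 \<le> t n \<and> t n \<le> T n \<and>
      \<gamma> * inner (g (X n)) (D n) \<le> inner (g (X n + t n *\<^sub>R D n)) (D n)"
    unfolding eventually_ex by blast
  have "t \<longlonglongrightarrow> 0"
    by (rule tendsto_sandwich[OF _ _ tendsto_const T(1)]) (use t in \<open>auto elim: eventually_mono\<close>)
  then have "(\<lambda>n. X n + t n *\<^sub>R D n) \<longlonglongrightarrow> x + 0 *\<^sub>R v"
    by (intro tendsto_intros X D)
  then have "(\<lambda>n. X n + t n *\<^sub>R D n) \<longlonglongrightarrow> x" by simp
  then have rhs: "(\<lambda>n. inner (g (X n + t n *\<^sub>R D n)) (D n)) \<longlonglongrightarrow> inner (g x) v"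
    by (intro tendsto_inner D isCont_tendsto_compose[OF g_cont])
  have lhs: "(\<lambda>n. \<gamma> * inner (g (X n)) (D n)) \<longlonglongrightarrow> \<gamma> * inner (g x) v"
    by (intro tendsto_intros D isCont_tendsto_compose[OF g_cont] X)
  show ?thesis
    by (rule tendsto_le[OF _ rhs lhs]) (use t in \<open>auto elim: eventually_mono\<close>)
qed

text \<open>
  The descent inequality together with Cauchy-Schwarz bounds the directions by \<open>\<parallel>g\<parallel> / c\<close>, so
  directions and step lengths have a common convergent subsequence, with limits \<open>v\<close> and \<open>a0\<close>.
  Whether or not \<open>a0\<close> vanishes, \<open>\<langle>g x, v\<rangle> \<ge> 0\<close>, and the descent inequality leaves only \<open>v = 0\<close>.
\<close>

lemma line_search_directions_vanish:
  fixes f :: "'a::euclidean_space \<Rightarrow> real"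
  assumes "open \<Omega>" and grad: "\<And>z. z \<in> \<Omega> \<Longrightarrow> GDERIV f z :> g z"
    and cont: "continuous_on \<Omega> g"
    and X: "X \<longlonglongrightarrow> x" "x \<in> \<Omega>"
    and a: "\<And>n. 0 < a n" "\<And>n. a n \<le> 1"
    and "c > 0" and desc: "\<And>n. inner (g (X n)) (D n) \<le> - c * (norm (D n))\<^sup>2"
    and slope: "(\<lambda>n. a n * inner (g (X n)) (D n)) \<longlonglongrightarrow> 0"
    and "\<gamma> < 1" "\<beta> > 0"
    and rejected: "\<And>n. a n = 1 \<or>
      f (X n + (a n / \<beta>) *\<^sub>R D n) \<ge> f (X n) + \<gamma> * (a n / \<beta>) * inner (g (X n)) (D n)"
  shows "\<exists>s. strict_mono s \<and> (D \<circ> s) \<longlonglongrightarrow> 0"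
proof -
  have g_cont: "isCont g x"
    using cont \<open>open \<Omega>\<close> X(2) by (simp add: continuous_on_eq_continuous_at)
  have g_lim: "(\<lambda>n. g (X n)) \<longlonglongrightarrow> g x"
    by (rule isCont_tendsto_compose[OF g_cont X(1)])
  then have "bounded (range (\<lambda>n. g (X n)))" by (rule convergent_imp_bounded)
  then obtain B where B: "\<And>n. norm (g (X n)) \<le> B" by (auto simp: bounded_iff)
  have D_le: "norm (D n) \<le> B / c" for n
  proof (cases "D n = 0")
    case True
    have "B \<ge> 0" using B[of n] norm_ge_zero order_trans by blast
    then show ?thesis using True \<open>c > 0\<close> by simp
  next
    case False
    have "c * (norm (D n))\<^sup>2 \<le> \<bar>inner (g (X n)) (D n)\<bar>" using desc[of n] by simp
    also have "\<dots> \<le> norm (g (X n)) * norm (D n)" by (rule Cauchy_Schwarz_ineq2)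
    also have "\<dots> \<le> B * norm (D n)" using B by (simp add: mult_right_mono)
    finally have "(c * norm (D n)) * norm (D n) \<le> B * norm (D n)"
      by (simp add: power2_eq_square algebra_simps)
    then have "c * norm (D n) \<le> B" using False by simp
    then show ?thesis using \<open>c > 0\<close> by (simp add: le_divide_eq mult.commute)
  qed
  have "bounded (range (\<lambda>n. (D n, a n)))"
  proof (rule boundedI)
    fix y assume "y \<in> range (\<lambda>n. (D n, a n))"
    then obtain n where "y = (D n, a n)" by auto
    then have "norm y \<le> norm (D n) + norm (a n)" by (simp only: norm_Pair_le)
    also have "\<dots> \<le> B / c + 1" using D_le[of n] a[of n] by (intro add_mono) auto
    finally show "norm y \<le> B / c + 1" .
  qed
  then obtain lim s where s: "strict_mono s" "((\<lambda>n. (D n, a n)) \<circ> s) \<longlonglongrightarrow> lim"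
    using bounded_imp_convergent_subsequence by blast
  obtain v a0 where "lim = (v, a0)" by (cases lim)
  with s(2) have D_lim: "(\<lambda>n. D (s n)) \<longlonglongrightarrow> v" and a_lim: "(\<lambda>n. a (s n)) \<longlonglongrightarrow> a0"
    using tendsto_fst[OF s(2)] tendsto_snd[OF s(2)] by (auto simp: o_def)
  have X_lim: "(\<lambda>n. X (s n)) \<longlonglongrightarrow> x"
    using LIMSEQ_subseq_LIMSEQ[OF X(1) s(1)] by (simp add: o_def)
  have gs_lim: "(\<lambda>n. g (X (s n))) \<longlonglongrightarrow> g x"
    by (rule isCont_tendsto_compose[OF g_cont X_lim])
  have "inner (g x) v \<ge> 0"
  proof (cases "a0 = 0")
    case True
    have "(\<lambda>n. a (s n) / \<beta>) \<longlonglongrightarrow> 0"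
      using tendsto_divide[OF a_lim tendsto_const, of \<beta>] True \<open>\<beta> > 0\<close> by simp
    moreover have "\<forall>\<^sub>F n in sequentially. f (X (s n) + (a (s n) / \<beta>) *\<^sub>R D (s n))
        \<ge> f (X (s n)) + \<gamma> * (a (s n) / \<beta>) * inner (g (X (s n))) (D (s n))"
      using order_tendstoD(2)[OF a_lim, of 1] True
      by (simp, elim eventually_mono) (use rejected in force)
    ultimately have "inner (g x) v \<ge> \<gamma> * inner (g x) v"
      using a(1) \<open>\<beta> > 0\<close>
      by (intro rejected_steps_limit_slope[where T = "\<lambda>n. a (s n) / \<beta>",
            OF \<open>open \<Omega>\<close> grad cont X_lim X(2) D_lim]) auto
    then have "0 \<le> (1 - \<gamma>) * inner (g x) v" by (simp add: algebra_simps)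
    then show ?thesis using \<open>\<gamma> < 1\<close> by (simp add: zero_le_mult_iff)
  next
    case False
    have "(\<lambda>n. a (s n) * inner (g (X (s n))) (D (s n))) \<longlonglongrightarrow> a0 * inner (g x) v"
      by (intro tendsto_intros a_lim gs_lim D_lim)
    moreover have "(\<lambda>n. a (s n) * inner (g (X (s n))) (D (s n))) \<longlonglongrightarrow> 0"
      using LIMSEQ_subseq_LIMSEQ[OF slope s(1)] by (simp add: o_def)
    ultimately have "a0 * inner (g x) v = 0" by (rule LIMSEQ_unique)
    then show ?thesis using False by simp
  qed
  moreover have "inner (g x) v \<le> - c * (norm v)\<^sup>2"
  proof (rule LIMSEQ_le)
    show "(\<lambda>n. inner (g (X (s n))) (D (s n))) \<longlonglongrightarrow> inner (g x) v"
      by (intro tendsto_intros gs_lim D_lim)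
    show "(\<lambda>n. - c * (norm (D (s n)))\<^sup>2) \<longlonglongrightarrow> - c * (norm v)\<^sup>2"
      by (intro tendsto_intros D_lim)
  qed (use desc in blast)
  ultimately have "c * (norm v)\<^sup>2 \<le> 0" by simp
  then have "v = 0" using \<open>c > 0\<close> by (simp add: mult_le_0_iff)
  then show ?thesis using s(1) D_lim by (auto simp: o_def)
qed

section \<open>Search directions of the method\<close>

text \<open>
  For a projected direction the sign is chosen so that \<open>\<langle>g, d\<rangle> = - \<bar>\<langle>g, dbar\<rangle>\<bar>\<close>, and the acceptance
  test supplies the constant \<open>\<eta>1\<close>.  For an inexact projected gradient step \<open>y\<close>, testing the defining
  inequality of \<open>y\<close> at the point \<open>x\<close> itself gives \<open>\<parallel>d\<parallel>\<^sup>2 + \<langle>g, d\<rangle> \<le> \<theta>\<^sup>2 \<parallel>d\<parallel>\<^sup>2\<close>.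
\<close>

lemma search_direction_descent:
  assumes "search_direction C F \<eta>1 \<eta>2 \<eta>3 \<theta> x p d" and "x \<in> C"
  shows "inner (gradient (merit F) x) d \<le> - min \<eta>1 (1 - \<theta>\<^sup>2) * (norm d)\<^sup>2"
proof -
  define g where "g = gradient (merit F) x"
  define c where "c = min \<eta>1 (1 - \<theta>\<^sup>2)"
  have "inner g d \<le> - c * (norm d)\<^sup>2"
  proof (cases "projected_direction_ok \<eta>1 \<eta>2 \<eta>3 g (p - x)")
    case True
    then have ok: "\<bar>inner g (p - x)\<bar> > \<eta>1 * (norm (p - x))\<^sup>2"
      and d: "d = - sgn (inner g (p - x)) *\<^sub>R (p - x)"
      using assms(1)
      by (auto simp: search_direction_def projected_direction_ok_def Let_def g_def)
    have "inner g d = - \<bar>inner g (p - x)\<bar>"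
      unfolding d by (simp add: sgn_if)
    moreover have "(norm d)\<^sup>2 \<le> (norm (p - x))\<^sup>2"
      unfolding d by (simp add: sgn_if)
    moreover have "\<eta>1 * (norm (p - x))\<^sup>2 \<ge> c * (norm (p - x))\<^sup>2"
      by (simp add: c_def mult_right_mono)
    \<comment> \<open>If the inner product is \<open>0\<close>, then so is its \<open>sgn\<close>, and \<open>d\<close> vanishes.\<close>
    moreover have "norm d = norm (p - x) \<or> inner g (p - x) = 0"
      unfolding d by (simp add: sgn_if)
    ultimately show ?thesis using ok by (auto simp: d)
  next
    case False
    then obtain y where y: "y \<in> C" "d = y - x"
      "\<And>z. z \<in> C \<Longrightarrow> inner (x - g - y) (z - y) \<le> \<theta>\<^sup>2 * (norm (y - x))\<^sup>2"
      using assms(1) by (auto simp: search_direction_def Let_def g_def)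
    have "inner (x - g - y) (x - y) = (norm d)\<^sup>2 + inner g d"
      unfolding y(2) by (simp add: power2_norm_eq_inner algebra_simps inner_commute)
    moreover have "inner (x - g - y) (x - y) \<le> \<theta>\<^sup>2 * (norm d)\<^sup>2"
      using y(3)[OF assms(2)] y(2) by simp
    ultimately have "inner g d \<le> - ((1 - \<theta>\<^sup>2) * (norm d)\<^sup>2)"
      by (simp add: left_diff_distrib)
    moreover have "(1 - \<theta>\<^sup>2) * (norm d)\<^sup>2 \<ge> c * (norm d)\<^sup>2"
      by (simp add: c_def mult_right_mono)
    ultimately show ?thesis by simp
  qed
  then show ?thesis by (simp add: g_def c_def)
qed

text \<open>
  A single bound serves both kinds of direction, so limits can be taken without splitting the
  sequence by the step that produced them.  For a projected direction \<open>\<parallel>g\<parallel> \<le> \<parallel>d\<parallel> / \<eta>2\<close> by the acceptance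
  test, and \<open>g\<close> itself becomes small with \<open>d\<close>.  For an inexact projected gradient step one
  rearranges its defining inequality tested at \<open>z\<close>.
\<close>

lemma search_direction_bounds_stationarity:
  assumes "search_direction C F \<eta>1 \<eta>2 \<eta>3 \<theta> x p d"
    and "x \<in> C" "z \<in> C" and "\<eta>1 > 0" "\<eta>2 > 0" and "\<theta>\<^sup>2 \<le> 1"
  shows "- inner (gradient (merit F) x) (z - x)
    \<le> norm d * ((1 + 1 / \<eta>2) * norm (z - x) + norm (gradient (merit F) x))"
proof -
  define g where "g = gradient (merit F) x"
  have "- inner g (z - x) \<le> norm d * ((1 + 1 / \<eta>2) * norm (z - x) + norm g)"
  proof (cases "projected_direction_ok \<eta>1 \<eta>2 \<eta>3 g (p - x)")
    case True
    then have ok: "\<bar>inner g (p - x)\<bar> > \<eta>1 * (norm (p - x))\<^sup>2"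
      "\<eta>2 * norm g \<le> norm (p - x)"
      and d: "d = - sgn (inner g (p - x)) *\<^sub>R (p - x)"
      using assms(1)
      by (auto simp: search_direction_def projected_direction_ok_def Let_def g_def)
    have "\<eta>1 * (norm (p - x))\<^sup>2 \<ge> 0" using assms(4) by simp
    then have "inner g (p - x) \<noteq> 0" using ok(1) by linarith
    then have "norm d = norm (p - x)" unfolding d by (simp add: sgn_if)
    then have g_le: "norm g \<le> norm d * (1 / \<eta>2)"
      using ok(2) assms(5) by (simp add: field_simps)
    have "- inner g (z - x) \<le> \<bar>inner g (z - x)\<bar>" by simp
    also have "\<dots> \<le> norm g * norm (z - x)" by (rule Cauchy_Schwarz_ineq2)
    also have "\<dots> \<le> (norm d * (1 / \<eta>2)) * norm (z - x)"
      using g_le by (rule mult_right_mono) simp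
    also have "\<dots> \<le> norm d * ((1 + 1 / \<eta>2) * norm (z - x) + norm g)"
      by (simp add: algebra_simps)
    finally show ?thesis .
  next
    case False
    then obtain y where y: "d = y - x"
      "\<And>z. z \<in> C \<Longrightarrow> inner (x - g - y) (z - y) \<le> \<theta>\<^sup>2 * (norm (y - x))\<^sup>2"
      using assms(1) by (auto simp: search_direction_def Let_def g_def)
    have "inner (x - g - y) (z - y)
        = - inner g (z - x) + inner g d - inner d (z - x) + (norm d)\<^sup>2"
      unfolding y(1) by (simp add: power2_norm_eq_inner algebra_simps inner_commute)
    moreover have "\<theta>\<^sup>2 * (norm d)\<^sup>2 \<le> (norm d)\<^sup>2"
      using mult_right_mono[OF assms(6), of "(norm d)\<^sup>2"] by simp
    ultimately have "- inner g (z - x) \<le> - inner g d + inner d (z - x)"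
      using y(2)[OF assms(3)] y(1) by simp
    also have "\<dots> \<le> \<bar>inner g d\<bar> + \<bar>inner d (z - x)\<bar>" by simp
    also have "\<dots> \<le> norm g * norm d + norm d * norm (z - x)"
      by (intro add_mono Cauchy_Schwarz_ineq2)
    also have "\<dots> \<le> norm d * ((1 + 1 / \<eta>2) * norm (z - x) + norm g)"
      using assms(5) by (simp add: algebra_simps)
    finally show ?thesis .
  qed
  then show ?thesis by (simp add: g_def)
qed

text \<open>
  Except for a reversed projected direction, the step moves from \<open>x k\<close> a fraction \<open>\<alpha> k \<le> 1\<close> of the way
  to a point of \<open>C\<close>.
\<close>

lemma glmm_iteration_stays_feasible:
  assumes it: "glmm_iteration C F M \<eta>1 \<eta>2 \<eta>3 \<gamma> \<beta> \<theta> x p d \<alpha> m k"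
    and rev: "reversal_feasible C F \<eta>1 \<eta>2 \<eta>3 x p k"
    and "convex C" "x k \<in> C" "\<eta>1 > 0" and "0 < \<beta>" "\<beta> < 1"
  shows "x (Suc k) \<in> C"
proof -
  define g where "g = gradient (merit F) (x k)"
  have sd: "search_direction C F \<eta>1 \<eta>2 \<eta>3 (\<theta> k) (x k) (p k) (d k)"
    and x_Suc: "x (Suc k) = x k + \<alpha> k *\<^sub>R d k"
    and bt: "backtracking_result \<beta> (sufficient_decrease (merit F) \<gamma> x m k (d k)) (\<alpha> k)"
    using it by (auto simp: glmm_iteration_def)
  note a = backtracking_result_bounds[OF bt assms(6,7)]
  have towards: "x (Suc k) \<in> C" if "d k = y - x k" "y \<in> C" for y
  proof -
    have "x (Suc k) = (1 - \<alpha> k) *\<^sub>R x k + \<alpha> k *\<^sub>R y"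
      unfolding x_Suc that(1) by (simp add: algebra_simps)
    then show ?thesis using a that(2) assms(3,4) by (auto intro!: convexD)
  qed
  show ?thesis
  proof (cases "projected_direction_ok \<eta>1 \<eta>2 \<eta>3 g (p k - x k)")
    case True
    then have "\<bar>inner g (p k - x k)\<bar> > \<eta>1 * (norm (p k - x k))\<^sup>2"
      by (auto simp: projected_direction_ok_def)
    moreover have "\<eta>1 * (norm (p k - x k))\<^sup>2 \<ge> 0" using assms(5) by simp
    ultimately have "inner g (p k - x k) \<noteq> 0" by linarith
    then consider "inner g (p k - x k) > 0" | "inner g (p k - x k) < 0" by linarith
    then show ?thesis
    proof cases
      case 1
      then show ?thesis using rev True by (auto simp: reversal_feasible_def Let_def g_def)
    next
      case 2
      then have "d k = p k - x k" "p k \<in> C"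
        using sd True by (auto simp: search_direction_def Let_def g_def eps_projection_def)
      then show ?thesis by (rule towards)
    qed
  next
    case False
    then show ?thesis
      using sd towards by (auto simp: search_direction_def Let_def g_def)
  qed
qed

section \<open>Termination of the backtracking and convergence to stationary points\<close>

theorem theorem10:
  fixes C \<Omega> :: "(real^'n) set" and F :: "real^'n \<Rightarrow> real^'m"
    and M :: nat and \<eta>1 \<eta>2 \<eta>3 \<gamma> \<beta> \<theta>bar :: real and \<theta> :: "nat \<Rightarrow> real"
    and x p d :: "nat \<Rightarrow> real^'n" and \<alpha> :: "nat \<Rightarrow> real" and m :: "nat \<Rightarrow> nat"
  assumes "open \<Omega>" and "C \<subseteq> \<Omega>" and "C \<noteq> {}" and "closed C" and "convex C"
    and "\<forall>z\<in>\<Omega>. F differentiable (at z)"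
    and "continuous_on \<Omega> (\<lambda>z. jacobian F (at z))"
    and "{z \<in> C. F z = 0} \<noteq> {}"
    and "\<eta>1 > 0" and "\<eta>3 > \<eta>2" and "\<eta>2 > 0"
    and "\<gamma> \<in> {0<..<1}" and "\<beta> \<in> {0<..<1}" and "\<forall>k. \<theta> k \<ge> 0"
    and "x 0 \<in> C" and "m 0 = 0"
    and "bounded {z \<in> C. merit F z \<le> merit F (x 0)}"
    and "\<forall>k. \<theta> k \<le> \<theta>bar" and "\<theta>bar < 1"
  shows
    "(\<forall>K. (\<forall>k<K. glmm_iteration C F M \<eta>1 \<eta>2 \<eta>3 \<gamma> \<beta> \<theta> x p d \<alpha> m k \<and>
                  reversal_feasible C F \<eta>1 \<eta>2 \<eta>3 x p k) \<longrightarrow>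
          search_direction C F \<eta>1 \<eta>2 \<eta>3 (\<theta> K) (x K) (p K) (d K) \<longrightarrow>
          (\<exists>i. sufficient_decrease (merit F) \<gamma> x m K (d K) (\<beta> ^ i))) \<and>
     ((\<forall>k. glmm_iteration C F M \<eta>1 \<eta>2 \<eta>3 \<gamma> \<beta> \<theta> x p d \<alpha> m k \<and>
           reversal_feasible C F \<eta>1 \<eta>2 \<eta>3 x p k) \<longrightarrow>
      (\<forall>r xbar. strict_mono r \<longrightarrow> (x \<circ> r) \<longlonglongrightarrow> xbar \<longrightarrow> stationary_point C (merit F) xbar))"
proof -
  define f where "f = merit F"
  define g where "g = gradient f"
  define V where "V k = (MAX j\<in>{..m k}. f (x (k - j)))" for k
  define c where "c = min \<eta>1 (1 - \<theta>bar\<^sup>2)"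
  have \<gamma>: "0 < \<gamma>" "\<gamma> < 1" and \<beta>: "0 < \<beta>" "\<beta> < 1" using assms(12,13) by auto
  have \<theta>bar: "\<theta>bar \<ge> 0" using assms(14,18) order_trans by blast
  have \<theta>_sq: "(\<theta> k)\<^sup>2 \<le> \<theta>bar\<^sup>2" for k
    using assms(14,18) by (simp add: power_mono)
  have \<theta>bar_sq: "\<theta>bar\<^sup>2 < 1" using \<theta>bar assms(19) by (simp add: abs_square_less_1)
  have "c > 0" unfolding c_def using assms(9) \<theta>bar_sq by simp
  have gderiv: "GDERIV f z :> F z v* jacobian F (at z)" if "z \<in> \<Omega>" for z
    unfolding f_def using that assms(6) by (intro GDERIV_merit) simp
  have g_eq: "g z = F z v* jacobian F (at z)" if "z \<in> \<Omega>" for z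
    unfolding g_def using gradient_eq[OF gderiv[OF that]] .
  have grad: "GDERIV f z :> g z" if "z \<in> \<Omega>" for z
    using gderiv[OF that] g_eq[OF that] by simp
  have F_cont: "continuous_on \<Omega> F"
    using assms(6) by (auto intro!: continuous_at_imp_continuous_on differentiable_imp_continuous_within)
  have g_cont: "continuous_on \<Omega> g"
    using continuous_on_vector_matrix_mult[OF F_cont assms(7)] g_eq
    by (simp cong: continuous_on_cong)
  have f_cont: "continuous_on \<Omega> f"
    unfolding f_def merit_def by (intro continuous_intros F_cont)
  have desc: "inner (g (x k)) (d k) \<le> - c * (norm (d k))\<^sup>2"
    if "search_direction C F \<eta>1 \<eta>2 \<eta>3 (\<theta> k) (x k) (p k) (d k)" "x k \<in> C" for k
  proof -
    have "c \<le> min \<eta>1 (1 - (\<theta> k)\<^sup>2)" unfolding c_def using \<theta>_sq[of k] by auto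
    then have "c * (norm (d k))\<^sup>2 \<le> min \<eta>1 (1 - (\<theta> k)\<^sup>2) * (norm (d k))\<^sup>2"
      by (rule mult_right_mono) simp
    then show ?thesis using search_direction_descent[OF that] by (simp add: g_def f_def)
  qed
  have f_le_V: "f (x k) \<le> V k" for k
    unfolding V_def using window_max_ge[of 0 m k "\<lambda>k. f (x k)"] by simp
  \<comment> \<open>Only iterations before \<open>K\<close> are assumed, so that this also serves the termination claim,
    where iteration \<open>K\<close> is not yet complete.\<close>
  have feasible: "x K \<in> C" if "\<forall>k<K. glmm_iteration C F M \<eta>1 \<eta>2 \<eta>3 \<gamma> \<beta> \<theta> x p d \<alpha> m k \<and>
      reversal_feasible C F \<eta>1 \<eta>2 \<eta>3 x p k" for K
    using that
  proof (induction K)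
    case 0
    then show ?case using assms(15) by simp
  next
    case (Suc K)
    then show ?case
      using glmm_iteration_stays_feasible[OF _ _ assms(5) _ assms(9) \<beta>, of F M \<eta>2 \<eta>3 \<gamma> \<theta> x p d \<alpha> m K]
      by auto
  qed
  have "\<exists>i. sufficient_decrease f \<gamma> x m K (d K) (\<beta> ^ i)"
    if K: "\<forall>k<K. glmm_iteration C F M \<eta>1 \<eta>2 \<eta>3 \<gamma> \<beta> \<theta> x p d \<alpha> m k \<and>
      reversal_feasible C F \<eta>1 \<eta>2 \<eta>3 x p k"
      and sd: "search_direction C F \<eta>1 \<eta>2 \<eta>3 (\<theta> K) (x K) (p K) (d K)" for K
  proof (cases "d K = 0")
    case True
    then show ?thesis using f_le_V[of K] by (simp add: sufficient_decrease_def V_def)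
  next
    case False
    have "x K \<in> C" using K by (rule feasible)
    have "c * (norm (d K))\<^sup>2 > 0" using False \<open>c > 0\<close> by simp
    then have "inner (g (x K)) (d K) < 0" using desc[OF sd \<open>x K \<in> C\<close>] by linarith
    then obtain i where "f (x K + \<beta> ^ i *\<^sub>R d K) \<le> f (x K) + \<gamma> * \<beta> ^ i * inner (g (x K)) (d K)"
      using armijo_backtracking_terminates[OF grad _ \<gamma>(2) \<beta>] assms(2) \<open>x K \<in> C\<close> by blast
    then have "sufficient_decrease f \<gamma> x m K (d K) (\<beta> ^ i)"
      using f_le_V[of K] by (simp add: sufficient_decrease_def V_def g_def)
    then show ?thesis by blast
  qed
  moreover have "stationary_point C f xbar"
    if run: "\<forall>k. glmm_iteration C F M \<eta>1 \<eta>2 \<eta>3 \<gamma> \<beta> \<theta> x p d \<alpha> m k \<and>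
        reversal_feasible C F \<eta>1 \<eta>2 \<eta>3 x p k"
      and r: "strict_mono r" and xr: "(x \<circ> r) \<longlonglongrightarrow> xbar" for r xbar
  proof -
    have sd: "search_direction C F \<eta>1 \<eta>2 \<eta>3 (\<theta> k) (x k) (p k) (d k)"
      and bt: "backtracking_result \<beta> (sufficient_decrease f \<gamma> x m k (d k)) (\<alpha> k)"
      and x_Suc: "x (Suc k) = x k + \<alpha> k *\<^sub>R d k"
      and m_Suc: "m (Suc k) \<le> min (m k + 1) M" for k
      using run by (auto simp: glmm_iteration_def f_def)
    have xC: "x k \<in> C" for k using run by (intro feasible) blast
    have a: "0 < \<alpha> k" "\<alpha> k \<le> 1" for k using backtracking_result_bounds[OF bt \<beta>] .
    define \<delta> where "\<delta> k = - (\<gamma> * (\<alpha> k * inner (g (x k)) (d k)))" for k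
    have dec: "f (x (Suc k)) \<le> V k - \<delta> k" for k
      using bt[of k] x_Suc[of k]
      by (auto simp: backtracking_result_def sufficient_decrease_def \<delta>_def V_def g_def mult.assoc)
    \<comment> \<open>One factor of \<open>\<alpha> k\<close> in \<open>(\<alpha> k)\<^sup>2 \<parallel>d k\<parallel>\<^sup>2\<close> is given away, as \<open>\<alpha> k \<le> 1\<close>.\<close>
    have \<delta>_ge: "\<delta> k \<ge> \<gamma> * c * (norm (x (Suc k) - x k))\<^sup>2" for k
    proof -
      have "(norm (x (Suc k) - x k))\<^sup>2 = (\<alpha> k * \<alpha> k) * (norm (d k))\<^sup>2"
        unfolding x_Suc by (simp add: power_mult_distrib power2_eq_square)
      also have "\<dots> \<le> \<alpha> k * (norm (d k))\<^sup>2"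
        using a[of k] by (intro mult_right_mono) (auto simp: mult_left_le)
      finally have "c * (norm (x (Suc k) - x k))\<^sup>2 \<le> c * (\<alpha> k * (norm (d k))\<^sup>2)"
        using \<open>c > 0\<close> by simp
      also have "\<dots> = \<alpha> k * (c * (norm (d k))\<^sup>2)" by simp
      also have "\<dots> \<le> \<alpha> k * (- inner (g (x k)) (d k))"
        using desc[OF sd xC, of k] a[of k] by (intro mult_left_mono) auto
      finally have "\<gamma> * (c * (norm (x (Suc k) - x k))\<^sup>2) \<le> \<gamma> * (\<alpha> k * (- inner (g (x k)) (d k)))"
        using \<gamma>(1) by (intro mult_left_mono) auto
      then show ?thesis by (simp add: \<delta>_def mult.assoc)
    qed
    have \<delta>_nonneg: "\<delta> k \<ge> 0" for k
    proof -
      have "\<gamma> * c * (norm (x (Suc k) - x k))\<^sup>2 \<ge> 0" using \<gamma>(1) \<open>c > 0\<close> by simp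
      then show ?thesis using \<delta>_ge[of k] by linarith
    qed
    define S where "S = {z \<in> C. f z \<le> f (x 0)}"
    have xS: "x k \<in> S" for k
    proof -
      have "V k \<le> f (x 0)"
        unfolding V_def
        by (rule window_le_initial[where \<phi> = "\<lambda>k. f (x k)" and \<delta> = \<delta>])
          (use assms(16) m_Suc dec \<delta>_nonneg in \<open>auto simp: V_def\<close>)
      then show ?thesis using xC f_le_V[of k] by (simp add: S_def)
    qed
    have "closed S"
      using continuous_closed_preimage[OF continuous_on_subset[OF f_cont assms(2)] assms(4)
          closed_atMost[of "f (x 0)"]]
      by (simp add: S_def Int_def vimage_def)
    then have "compact S"
      using assms(17) by (simp add: compact_eq_bounded_closed S_def f_def)
    then have unif: "uniformly_continuous_on S f"
      using assms(2) f_cont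
      by (intro compact_uniformly_continuous) (auto simp: S_def intro: continuous_on_subset)
    have "\<delta> \<longlonglongrightarrow> 0"
    proof (rule nonmonotone_decrease_tendsto_0[where \<phi> = "\<lambda>k. f (x k)" and b = 0])
      show "0 \<le> f (x k)" for k by (simp add: f_def merit_def)
      fix \<epsilon> :: real assume "\<epsilon> > 0"
      then obtain \<rho> where "\<rho> > 0" and
        \<rho>: "\<And>y z. y \<in> S \<Longrightarrow> z \<in> S \<Longrightarrow> dist z y < \<rho> \<Longrightarrow> dist (f z) (f y) < \<epsilon>"
        using unif unfolding uniformly_continuous_on_def by metis
      have "\<bar>f (x (Suc k)) - f (x k)\<bar> < \<epsilon>" if "\<delta> k < \<gamma> * c * \<rho>\<^sup>2" for k
      proof -
        have "\<gamma> * c * (norm (x (Suc k) - x k))\<^sup>2 < \<gamma> * c * \<rho>\<^sup>2"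
          using \<delta>_ge[of k] that by linarith
        then have "(norm (x (Suc k) - x k))\<^sup>2 < \<rho>\<^sup>2" using \<gamma>(1) \<open>c > 0\<close> by simp
        then have "dist (x (Suc k)) (x k) < \<rho>"
          using \<open>\<rho> > 0\<close> unfolding dist_norm by (rule power2_less_imp_less[OF _ less_imp_le])
        then show ?thesis using \<rho>[OF xS xS] unfolding dist_real_def by blast
      qed
      then show "\<exists>\<eta>>0. \<forall>k. \<delta> k < \<eta> \<longrightarrow> \<bar>f (x (Suc k)) - f (x k)\<bar> < \<epsilon>"
        using \<open>\<rho> > 0\<close> \<gamma>(1) \<open>c > 0\<close> by (intro exI[of _ "\<gamma> * c * \<rho>\<^sup>2"]) auto
    qed (fact assms(16) m_Suc dec[unfolded V_def] \<delta>_nonneg)+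
    then have slope: "(\<lambda>k. \<alpha> k * inner (g (x k)) (d k)) \<longlonglongrightarrow> 0"
      using tendsto_divide[OF _ tendsto_const, of \<delta> 0 sequentially "- \<gamma>"] \<gamma>(1)
      by (simp add: \<delta>_def)
    have rejected: "\<alpha> k = 1 \<or>
        f (x k + (\<alpha> k / \<beta>) *\<^sub>R d k) \<ge> f (x k) + \<gamma> * (\<alpha> k / \<beta>) * inner (g (x k)) (d k)" for k
      using backtracking_result_previous_fails[OF bt[of k] \<beta>(1)] f_le_V[of k]
      by (auto simp: sufficient_decrease_def V_def g_def)
    have "xbar \<in> C"
      using closed_sequentially[OF assms(4) _ xr] xC by simp
    then have "xbar \<in> \<Omega>" using assms(2) by blast
    have "\<exists>s. strict_mono s \<and> ((d \<circ> r) \<circ> s) \<longlonglongrightarrow> 0"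
    proof (rule line_search_directions_vanish[OF assms(1) grad g_cont xr \<open>xbar \<in> \<Omega>\<close>
          _ _ \<open>c > 0\<close> _ _ \<gamma>(2) \<beta>(1)])
      show "(\<lambda>n. (\<alpha> \<circ> r) n * inner (g ((x \<circ> r) n)) ((d \<circ> r) n)) \<longlonglongrightarrow> 0"
        using LIMSEQ_subseq_LIMSEQ[OF slope r] by (simp add: o_def)
    qed (use a desc[OF sd xC] rejected in auto)
    then obtain s where s: "strict_mono s" "(\<lambda>n. d (r (s n))) \<longlonglongrightarrow> 0"
      by (auto simp: o_def)
    have xs: "(\<lambda>n. x (r (s n))) \<longlonglongrightarrow> xbar"
      using LIMSEQ_subseq_LIMSEQ[OF xr s(1)] by (simp add: o_def)
    have gs: "(\<lambda>n. g (x (r (s n)))) \<longlonglongrightarrow> g xbar"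
      using g_cont assms(1) \<open>xbar \<in> \<Omega>\<close>
      by (intro isCont_tendsto_compose[OF _ xs]) (simp add: continuous_on_eq_continuous_at)
    have "inner (g xbar) (z - xbar) \<ge> 0" if "z \<in> C" for z
    proof -
      have "- inner (g xbar) (z - xbar)
          \<le> norm (0 :: real^'n) * ((1 + 1 / \<eta>2) * norm (z - xbar) + norm (g xbar))"
      proof (rule LIMSEQ_le)
        show "(\<lambda>n. - inner (g (x (r (s n)))) (z - x (r (s n)))) \<longlonglongrightarrow> - inner (g xbar) (z - xbar)"
          by (intro tendsto_intros xs gs)
        show "(\<lambda>n. norm (d (r (s n))) *
            ((1 + 1 / \<eta>2) * norm (z - x (r (s n))) + norm (g (x (r (s n))))))
          \<longlonglongrightarrow> norm (0 :: real^'n) * ((1 + 1 / \<eta>2) * norm (z - xbar) + norm (g xbar))"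
          by (intro tendsto_intros xs gs s(2))
        have "(\<theta> k)\<^sup>2 \<le> 1" for k using \<theta>_sq[of k] \<theta>bar_sq by linarith
        then show "\<exists>N. \<forall>n\<ge>N. - inner (g (x (r (s n)))) (z - x (r (s n)))
            \<le> norm (d (r (s n))) *
              ((1 + 1 / \<eta>2) * norm (z - x (r (s n))) + norm (g (x (r (s n)))))"
          using search_direction_bounds_stationarity[OF sd xC that assms(9,11)]
          by (simp add: g_def f_def)
      qed
      then show ?thesis by simp
    qed
    then show ?thesis using \<open>xbar \<in> C\<close> by (simp add: stationary_point_def g_def)
  qed
  ultimately show ?thesis unfolding f_def by blast
qed

end
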